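(* For every positive integer $n$, the number $\lambda(n)$ of isomorphism classes of linear $L$-algebras with exactly $n$ elements equals the Bell number $B(n-1)$, i.e. the number of partitions of a set with $n-1$ elements into non-empty subsets (with $B(0)=1$).
   Context: An $L$-algebra is a set $X$ together with a binary operation $(x,y)\mapsto x\cdot y$ such that: (i) there exists $e\in X$ with $e\cdot x=x$ and $x\cdot e=x\cdot x=e$ for all $x\in X$; (ii) $(x\cdot y)\cdot(x\cdot z)=(y\cdot x)\cdot(y\cdot z)$ for all $x,y,z\in X$; (iii) if $x\cdot y=y\cdot x=e$, then $x=y$. The natural order is the partial order $x\le y\iff x\cdot y=e$. An $L$-algebra is linear if for all $x,y\in X$, $x\le y$ or $y\le x$. An isomorphism of $L$-algebras is a bijection $f$ with $f(x\cdot y)=f(x)\cdot f(y)$ for all $x,y$. *)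

theory Defs
  imports Main "HOL-Library.Disjoint_Sets"
begin

definition logical_unit :: "'a set \<Rightarrow> ('a \<Rightarrow> 'a \<Rightarrow> 'a) \<Rightarrow> 'a \<Rightarrow> bool" where
  "logical_unit X f e \<longleftrightarrow>
     e \<in> X \<and> (\<forall>x\<in>X. f e x = x \<and> f x e = e \<and> f x x = e)"

definition L_algebra :: "'a set \<Rightarrow> ('a \<Rightarrow> 'a \<Rightarrow> 'a) \<Rightarrow> bool" where
  "L_algebra X f \<longleftrightarrow>
     (\<forall>x\<in>X. \<forall>y\<in>X. f x y \<in> X) \<and>
     (\<forall>x\<in>X. \<forall>y\<in>X. \<forall>z\<in>X. f (f x y) (f x z) = f (f y x) (f y z)) \<and>
     (\<exists>e. logical_unit X f e \<and> (\<forall>x\<in>X. \<forall>y\<in>X. f x y = e \<and> f y x = e \<longrightarrow> x = y))"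

definition L_unit :: "'a set \<Rightarrow> ('a \<Rightarrow> 'a \<Rightarrow> 'a) \<Rightarrow> 'a" where
  "L_unit X f = (THE e. logical_unit X f e)"

definition L_le :: "'a set \<Rightarrow> ('a \<Rightarrow> 'a \<Rightarrow> 'a) \<Rightarrow> 'a \<Rightarrow> 'a \<Rightarrow> bool" where
  "L_le X f x y \<longleftrightarrow> f x y = L_unit X f"

definition linear_L_algebra :: "'a set \<Rightarrow> ('a \<Rightarrow> 'a \<Rightarrow> 'a) \<Rightarrow> bool" where
  "linear_L_algebra X f \<longleftrightarrow>
     L_algebra X f \<and> (\<forall>x\<in>X. \<forall>y\<in>X. L_le X f x y \<or> L_le X f y x)"

definition L_isomorphic ::
    "'a set \<times> ('a \<Rightarrow> 'a \<Rightarrow> 'a) \<Rightarrow> 'b set \<times> ('b \<Rightarrow> 'b \<Rightarrow> 'b) \<Rightarrow> bool" where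
  "L_isomorphic = (\<lambda>(X, f) (Y, g).
     \<exists>h. bij_betw h X Y \<and> (\<forall>x\<in>X. \<forall>y\<in>X. h (f x y) = g (h x) (h y)))"

text \<open>
  The carriers range over all \<open>n\<close>-element sets of natural numbers. This loses nothing: by
  \<open>linear_L_algebra_nat_copy\<close> below, every finite linear \<open>L\<close>-algebra, over any type, is isomorphic
  to one of these. The values of an operation outside its carrier are irrelevant, since operations
  that agree on the carrier give isomorphic structures and hence the same class.
\<close>

definition linear_L_algebras :: "nat \<Rightarrow> (nat set \<times> (nat \<Rightarrow> nat \<Rightarrow> nat)) set" where
  "linear_L_algebras n = {(X, f). finite X \<and> card X = n \<and> linear_L_algebra X f}"

definition L_iso_rel ::
    "nat \<Rightarrow> ((nat set \<times> (nat \<Rightarrow> nat \<Rightarrow> nat)) \<times> (nat set \<times> (nat \<Rightarrow> nat \<Rightarrow> nat))) set" where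
  "L_iso_rel n =
     {(A, B). A \<in> linear_L_algebras n \<and> B \<in> linear_L_algebras n \<and> L_isomorphic A B}"

definition num_linear_L_algebras :: "nat \<Rightarrow> nat" where
  "num_linear_L_algebras n = card (linear_L_algebras n // L_iso_rel n)"

definition Bell :: "nat \<Rightarrow> nat" where
  "Bell n = card {P. partition_on {..<n} P}"

lemma Bell_0: "Bell 0 = 1"
proof -
  have "{P :: nat set set. partition_on {..<0} P} = {{}}"
    by (auto simp: partition_on_def)
  then show ?thesis by (simp add: Bell_def)
qed

lemma logical_unit_unique:
  assumes "logical_unit X f e" "logical_unit X f e'"
  shows "e = e'"
  using assms unfolding logical_unit_def by metis

lemma L_unit_eq:
  assumes "logical_unit X f e"
  shows "L_unit X f = e"
  unfolding L_unit_def using assms logical_unit_unique by (metis the_equality)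

lemma L_isomorphic_refl: "L_isomorphic A A"
  unfolding L_isomorphic_def by (auto intro!: exI[of _ id] split: prod.split)

lemma L_isomorphic_trans:
  assumes "L_isomorphic A B" "L_isomorphic B C"
  shows "L_isomorphic A C"
proof -
  obtain X f Y g Z k where eq: "A = (X, f)" "B = (Y, g)" "C = (Z, k)"
    by (metis surj_pair)
  obtain h1 h2 where
    h1: "bij_betw h1 X Y" "\<forall>x\<in>X. \<forall>y\<in>X. h1 (f x y) = g (h1 x) (h1 y)" and
    h2: "bij_betw h2 Y Z" "\<forall>x\<in>Y. \<forall>y\<in>Y. h2 (g x y) = k (h2 x) (h2 y)"
    using assms unfolding eq L_isomorphic_def by auto
  have "bij_betw (h2 \<circ> h1) X Z" using h1(1) h2(1) by (rule bij_betw_trans)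
  moreover have "\<forall>x\<in>X. \<forall>y\<in>X. (h2 \<circ> h1) (f x y) = k ((h2 \<circ> h1) x) ((h2 \<circ> h1) y)"
    using h1 h2(2) by (auto simp: bij_betw_def)
  ultimately show ?thesis unfolding eq L_isomorphic_def by blast
qed

lemma L_isomorphic_sym:
  assumes "L_isomorphic (X, f) (Y, g)" and closed: "\<forall>x\<in>X. \<forall>y\<in>X. f x y \<in> X"
  shows "L_isomorphic (Y, g) (X, f)"
proof -
  obtain h where h: "bij_betw h X Y" "\<forall>x\<in>X. \<forall>y\<in>X. h (f x y) = g (h x) (h y)"
    using assms unfolding L_isomorphic_def by auto
  define i where "i = inv_into X h"
  have i: "bij_betw i Y X" unfolding i_def using h(1) by (rule bij_betw_inv_into)
  have "i (g x y) = f (i x) (i y)" if "x \<in> Y" "y \<in> Y" for x y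
  proof -
    have m: "i x \<in> X" "i y \<in> X" using i that by (auto simp: bij_betw_def)
    have "h (i x) = x" "h (i y) = y"
      using that h(1) unfolding i_def by (auto simp: bij_betw_inv_into_right)
    then have "g x y = h (f (i x) (i y))" using h(2) m by simp
    then show ?thesis
      using closed m h(1) unfolding i_def by (simp add: bij_betw_inv_into_left)
  qed
  with i show ?thesis unfolding L_isomorphic_def by auto
qed

lemma equiv_L_iso_rel: "equiv (linear_L_algebras n) (L_iso_rel n)"
proof (rule equivI)
  show "L_iso_rel n \<subseteq> linear_L_algebras n \<times> linear_L_algebras n"
    by (auto simp: L_iso_rel_def)
  show "refl_on (linear_L_algebras n) (L_iso_rel n)"
    by (auto simp: refl_on_def L_iso_rel_def L_isomorphic_refl)
  show "sym (L_iso_rel n)"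
    by (auto simp: sym_def L_iso_rel_def linear_L_algebras_def linear_L_algebra_def L_algebra_def
        intro!: L_isomorphic_sym)
  show "trans (L_iso_rel n)"
    by (auto simp: trans_def L_iso_rel_def intro: L_isomorphic_trans)
qed

lemma linear_L_algebra_nat_copy:
  fixes X :: "'a set"
  assumes lin: "linear_L_algebra X f" and fin: "finite X"
  shows "\<exists>A \<in> linear_L_algebras (card X). L_isomorphic (X, f) A"
proof -
  define Y where "Y = {0..<card X}"
  obtain h :: "'a \<Rightarrow> nat" where h: "bij_betw h X Y"
    using ex_bij_betw_finite_nat[OF fin] Y_def by blast
  define i where "i = inv_into X h"
  define g where "g u v = h (f (i u) (i v))" for u v
  have hX: "h ` X = Y" using h by (auto simp: bij_betw_def)
  have ih: "\<And>x. x \<in> X \<Longrightarrow> i (h x) = x"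
    unfolding i_def using h by (simp add: bij_betw_inv_into_left)
  have inj: "\<And>x y. x \<in> X \<Longrightarrow> y \<in> X \<Longrightarrow> h x = h y \<longleftrightarrow> x = y"
    using h by (auto simp: bij_betw_def inj_on_def)
  have gh: "\<And>x y. x \<in> X \<Longrightarrow> y \<in> X \<Longrightarrow> g (h x) (h y) = h (f x y)"
    by (simp add: g_def ih)
  have closed: "\<And>x y. x \<in> X \<Longrightarrow> y \<in> X \<Longrightarrow> f x y \<in> X"
    and cycloid: "\<And>x y z. x \<in> X \<Longrightarrow> y \<in> X \<Longrightarrow> z \<in> X \<Longrightarrow> f (f x y) (f x z) = f (f y x) (f y z)"
    using lin by (auto simp: linear_L_algebra_def L_algebra_def)
  obtain e where e: "logical_unit X f e"
    and anti: "\<And>x y. x \<in> X \<Longrightarrow> y \<in> X \<Longrightarrow> f x y = e \<Longrightarrow> f y x = e \<Longrightarrow> x = y"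
    using lin unfolding linear_L_algebra_def L_algebra_def by blast
  have eX: "e \<in> X" using e by (simp add: logical_unit_def)
  have tot: "\<And>x y. x \<in> X \<Longrightarrow> y \<in> X \<Longrightarrow> f x y = e \<or> f y x = e"
    using lin L_unit_eq[OF e] by (auto simp: linear_L_algebra_def L_le_def)
  have u: "logical_unit Y g (h e)"
    using e eX unfolding logical_unit_def hX[symmetric] by (simp add: gh)
  have "L_algebra Y g"
    unfolding L_algebra_def
  proof (intro conjI exI[of _ "h e"])
    show "\<forall>x\<in>Y. \<forall>y\<in>Y. g x y \<in> Y"
      unfolding hX[symmetric] by (auto simp: gh closed)
    show "\<forall>x\<in>Y. \<forall>y\<in>Y. \<forall>z\<in>Y. g (g x y) (g x z) = g (g y x) (g y z)"
      unfolding hX[symmetric] by (simp add: gh closed cycloid)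
    show "\<forall>x\<in>Y. \<forall>y\<in>Y. g x y = h e \<and> g y x = h e \<longrightarrow> x = y"
      unfolding hX[symmetric] by (auto simp: gh closed inj eX anti)
  qed (rule u)
  moreover have "\<forall>x\<in>Y. \<forall>y\<in>Y. L_le Y g x y \<or> L_le Y g y x"
    unfolding L_le_def L_unit_eq[OF u] unfolding hX[symmetric] using tot by (auto simp: gh closed inj eX)
  ultimately have "(Y, g) \<in> linear_L_algebras (card X)"
    by (simp add: linear_L_algebras_def linear_L_algebra_def Y_def)
  moreover have "L_isomorphic (X, f) (Y, g)"
    using h gh unfolding L_isomorphic_def by auto
  ultimately show ?thesis by blast
qed

end

theory Submission
  imports Defs "HOL.Binomial"
begin

text \<open>
  Number the elements of a linear \<open>L\<close>-algebra \<open>0, \<dots>, n - 1\<close> from the top. The rows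
  \<open>k \<mapsto> f i k\<close> are strictly increasing on \<open>{i..<n}\<close> with \<open>f i i = 0\<close>, and the defining equation
  becomes \<open>f (f i j) (f i k) = f j k\<close> for \<open>i \<le> j \<le> k\<close>. Chains are rigid, so isomorphism
  classes are such operations. Let \<open>g\<close> be the first row that moves the bottom element
  \<open>n - 1\<close>. Applying the equation to a row \<open>i < g\<close> and the bottom element shows that \<open>f i\<close> fixes \<open>g\<close>,
  hence everything from \<open>g\<close> on. The later rows are determined by row \<open>g\<close>, because
  \<open>f j k = f (f g j) (f g k)\<close> with \<open>f g j < j\<close>. Conversely, any operation on \<open>{..<g}\<close> and any strictly
  increasing row \<open>{g<..<n} \<rightarrow> {1..n - 2}\<close> can be combined in this way. Therefore
  \<open>\<lambda>(n) = (\<Sum>g=1..n - 1. (n - 2 choose g - 1) * \<lambda>(g))\<close>, which is the recurrence of the Bell numbers.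
\<close>

section \<open>Bell numbers\<close>

text \<open>\<open>Bell\<close> refers to initial segments only, while the recurrence needs
  arbitrary finite sets. A numbering of \<open>A\<close> transports partitions by taking images of
  blocks.\<close>

lemma card_partitions_eq_Bell:
  assumes "finite A"
  shows "card {P. partition_on A P} = Bell (card A)"
proof -
  obtain h where h: "bij_betw h A {..<card A}"
    using ex_bij_betw_finite_nat[OF assms] by (auto simp: atLeast0LessThan)
  define i where "i = inv_into A h"
  have hA: "h ` A = {..<card A}" "inj_on h A" using h by (auto simp: bij_betw_def)
  have iA: "i ` {..<card A} = A" "inj_on i {..<card A}"
    using bij_betw_inv_into[OF h] by (auto simp: bij_betw_def i_def)
  have ih: "i (h x) = x" if "x \<in> A" for x
    using that hA by (simp add: i_def)
  have hi: "h (i x) = x" if "x < card A" for x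
    using that hA by (simp add: i_def f_inv_into_f)
  have ihS: "(`) i ` (`) h ` P = P" if "partition_on A P" for P
  proof -
    have "i ` h ` p = p" if "p \<in> P" for p
    proof -
      have "\<forall>x\<in>p. i (h x) = x"
        using that \<open>partition_on A P\<close> ih by (auto dest: partition_onD1)
      then show ?thesis by (force simp: image_iff)
    qed
    then show ?thesis by (simp add: image_image)
  qed
  have hiS: "(`) h ` (`) i ` P = P" if "partition_on {..<card A} P" for P
  proof -
    have "h ` i ` p = p" if "p \<in> P" for p
    proof -
      have "\<forall>x\<in>p. h (i x) = x"
        using that \<open>partition_on {..<card A} P\<close> hi by (auto dest: partition_onD1)
      then show ?thesis by (force simp: image_iff)
    qed
    then show ?thesis by (simp add: image_image)
  qed
  have "bij_betw ((`) ((`) h)) {P. partition_on A P} {P. partition_on {..<card A} P}"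
  proof (rule bij_betw_byWitness[where f' = "(`) ((`) i)"])
    show "(`) ((`) h) ` {P. partition_on A P} \<subseteq> {P. partition_on {..<card A} P}"
    proof clarify
      fix P assume P: "partition_on A P"
      \<comment> \<open>\<open>partition_on_inj_image\<close> discards empty images; since no block
        is empty, nothing is discarded here.\<close>
      have "(`) h ` P - {{}} = (`) h ` P" using partition_onD3[OF P] by auto
      then show "partition_on {..<card A} ((`) h ` P)"
        using partition_on_inj_image[OF P hA(2)] by (simp add: hA)
    qed
    show "(`) ((`) i) ` {P. partition_on {..<card A} P} \<subseteq> {P. partition_on A P}"
    proof clarify
      fix P assume P: "partition_on {..<card A} P"
      have "(`) i ` P - {{}} = (`) i ` P" using partition_onD3[OF P] by auto
      then show "partition_on A ((`) i ` P)"
        using partition_on_inj_image[OF P iA(2)] by (simp add: iA)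
    qed
  qed (use ihS hiS in auto)
  then show ?thesis
    unfolding Bell_def by (rule bij_betw_same_card)
qed

lemma sum_Pow_card:
  fixes F :: "nat \<Rightarrow> nat"
  assumes "finite S"
  shows "(\<Sum>A\<in>Pow S. F (card A)) = (\<Sum>k\<le>card S. (card S choose k) * F k)"
proof -
  have "(\<Sum>A\<in>Pow S. F (card A)) = (\<Sum>k\<le>card S. \<Sum>A\<in>{A \<in> Pow S. card A = k}. F (card A))"
    by (rule sum.group[symmetric]) (use assms in \<open>auto intro: card_mono\<close>)
  also have "\<dots> = (\<Sum>k\<le>card S. card {A. A \<subseteq> S \<and> card A = k} * F k)"
    by (rule sum.cong) auto
  finally show ?thesis using assms by (simp add: n_subsets)
qed

text \<open>Deleting the block of \<open>m\<close> leaves a partition of a subset of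
  \<open>{..<m}\<close>, and that subset determines the deleted block.\<close>

lemma Bell_Suc: "Bell (Suc m) = (\<Sum>k\<le>m. (m choose k) * Bell k)"
proof -
  define D where "D = Sigma (Pow {..<m}) (\<lambda>R. {Q. partition_on R Q})"
  \<comment> \<open>\<open>R\<close> is the complement of the block that contains the largest point \<open>m\<close>.\<close>
  define F where "F = (\<lambda>(R, Q). insert ({..m} - R) (Q :: nat set set))"
  have inj: "inj_on F D"
  proof (rule inj_onI, clarify)
    fix R Q R' Q' assume D: "(R, Q) \<in> D" "(R', Q') \<in> D" and eq: "F (R, Q) = F (R', Q')"
    have R: "R \<subseteq> {..<m}" "R' \<subseteq> {..<m}" "\<Union>Q = R" "\<Union>Q' = R'"
      using D by (auto simp: D_def partition_on_def)
    have m: "m \<in> {..m} - R" "m \<in> {..m} - R'" "m \<notin> \<Union>Q" "m \<notin> \<Union>Q'"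
      using R by auto
    \<comment> \<open>Only the added block contains \<open>m\<close>, so membership of
      \<open>m\<close> separates it from \<open>Q\<close> again.\<close>
    have "{p \<in> F (R, Q). m \<in> p} = {{..m} - R}" "{p \<in> F (R', Q'). m \<in> p} = {{..m} - R'}"
      "{p \<in> F (R, Q). m \<notin> p} = Q" "{p \<in> F (R', Q'). m \<notin> p} = Q'"
      using m by (auto simp: F_def)
    then have "{..m} - R = {..m} - R'" "Q = Q'" using eq by auto
    then show "R = R' \<and> Q = Q'" using R by auto
  qed
  have "F ` D = {P. partition_on {..<Suc m} P}"
  proof (intro equalityI subsetI)
    fix P assume "P \<in> F ` D"
    then obtain R Q where P: "P = insert ({..m} - R) Q" "R \<subseteq> {..<m}" "partition_on R Q"
      by (auto simp: D_def F_def)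
    have dis: "disjnt ({..m} - R) (\<Union>Q)"
      using P(3) by (auto simp: partition_on_def disjnt_def)
    have "{..<Suc m} - ({..m} - R) = R" using P(2) by auto
    moreover have "m \<in> {..m} - R" using P(2) by auto
    ultimately show "P \<in> {P. partition_on {..<Suc m} P}"
      using P by (auto simp: partition_on_insert[OF dis])
  next
    fix P assume "P \<in> {P. partition_on {..<Suc m} P}"
    then have P: "partition_on {..<Suc m} P" by simp
    then obtain p where p: "p \<in> P" "m \<in> p" by (auto simp: partition_on_def)
    have dis: "disjnt p (\<Union>(P - {p}))"
      using P p by (auto simp: partition_on_def disjnt_def pairwise_def)
    have "partition_on ({..<Suc m} - p) (P - {p})" "p \<subseteq> {..<Suc m}"
      using P p(1) partition_on_insert[OF dis, of "{..<Suc m}"] by (auto simp: insert_absorb)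
    moreover have "{..m} - ({..<Suc m} - p) = p" using \<open>p \<subseteq> {..<Suc m}\<close> by auto
    moreover have "{..<Suc m} - p \<subseteq> {..<m}"
      using p(2) by (auto simp: less_Suc_eq)
    ultimately have "({..<Suc m} - p, P - {p}) \<in> D" "F ({..<Suc m} - p, P - {p}) = P"
      using p(1) by (auto simp: D_def F_def)
    then show "P \<in> F ` D" by (metis imageI)
  qed
  then have "Bell (Suc m) = card D"
    using card_image[OF inj] by (simp add: Bell_def)
  also have "\<dots> = (\<Sum>R\<in>Pow {..<m}. card {Q. partition_on R Q})"
    unfolding D_def by (rule card_SigmaI) (auto intro: finitely_many_partition_on finite_subset)
  also have "\<dots> = (\<Sum>R\<in>Pow {..<m}. Bell (card R))"
    by (rule sum.cong) (auto intro: card_partitions_eq_Bell finite_subset)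
  also have "\<dots> = (\<Sum>k\<le>m. (m choose k) * Bell k)"
    by (simp add: sum_Pow_card)
  finally show ?thesis .
qed

section \<open>Increasing maps\<close>

text \<open>Each step gains at least 1. Taken up to the last index, this lets a bound on the last
  value pull down all earlier values.\<close>

lemma strict_mono_bounded_le:
  fixes \<psi> :: "nat \<Rightarrow> nat"
  assumes mono: "\<And>k l. a \<le> k \<Longrightarrow> k < l \<Longrightarrow> l < n \<Longrightarrow> \<psi> k < \<psi> l"
    and "a \<le> k" "k \<le> l" "l < n"
  shows "\<psi> k + (l - k) \<le> \<psi> l"
  using \<open>k \<le> l\<close> \<open>l < n\<close>
proof (induction l rule: dec_induct)
  case (step l)
  then have "\<psi> l < \<psi> (Suc l)" using mono[of l "Suc l"] \<open>a \<le> k\<close> by simp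
  with step show ?case by simp
qed simp

text \<open>These are the candidates for row \<open>g\<close>. The strict bound \<open>n - 1\<close>
  makes the row move the bottom element; the value 0 elsewhere makes equality of rows equality of
  functions.\<close>

definition increasing_maps :: "nat \<Rightarrow> nat \<Rightarrow> (nat \<Rightarrow> nat) set" where
  "increasing_maps g n = {\<psi>. (\<forall>k. \<not> (g < k \<and> k < n) \<longrightarrow> \<psi> k = 0) \<and>
     (\<forall>k. g < k \<and> k < n \<longrightarrow> 1 \<le> \<psi> k \<and> \<psi> k < n - 1) \<and>
     (\<forall>k l. g < k \<and> k < l \<and> l < n \<longrightarrow> \<psi> k < \<psi> l)}"

text \<open>A strictly increasing map is determined by its image, which can be any subset of
  \<open>{1..<n - 1}\<close> with as many elements as there are indices strictly between
  \<open>g\<close> and \<open>n\<close>.\<close>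

lemma card_increasing_maps:
  assumes "g < n"
  shows "finite (increasing_maps g n)"
    and "card (increasing_maps g n) = (n - 2) choose (n - 1 - g)"
proof -
  define \<A> where "\<A> = {A. A \<subseteq> {1..<n - 1} \<and> card A = n - 1 - g}"
  define I where "I = {g<..<n}"
  have sorted: "sorted_wrt (<) (map \<psi> [Suc g..<n])" "set (map \<psi> [Suc g..<n]) = \<psi> ` I"
    if "\<psi> \<in> increasing_maps g n" for \<psi>
    using that by (auto simp: increasing_maps_def sorted_wrt_iff_nth_less I_def)
  have bij: "bij_betw (\<lambda>\<psi>. \<psi> ` I) (increasing_maps g n) \<A>"
  proof (rule bij_betw_imageI)
    show "inj_on (\<lambda>\<psi>. \<psi> ` I) (increasing_maps g n)"
    proof (rule inj_onI)
      fix \<psi> \<psi>' assume *: "\<psi> \<in> increasing_maps g n" "\<psi>' \<in> increasing_maps g n" "\<psi> ` I = \<psi>' ` I"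
      then have "map \<psi> [Suc g..<n] = map \<psi>' [Suc g..<n]"
        using sorted by (intro strict_sorted_equal) auto
      then have "\<psi> k = \<psi>' k" if "g < k" "k < n" for k using that by auto
      moreover have "\<psi> k = \<psi>' k" if "\<not> (g < k \<and> k < n)" for k
        using * that by (simp add: increasing_maps_def)
      ultimately show "\<psi> = \<psi>'" by blast
    qed
    show "(\<lambda>\<psi>. \<psi> ` I) ` increasing_maps g n = \<A>"
    proof (intro equalityI subsetI)
      fix A assume "A \<in> (\<lambda>\<psi>. \<psi> ` I) ` increasing_maps g n"
      then obtain \<psi> where \<psi>: "\<psi> \<in> increasing_maps g n" "A = \<psi> ` I" by auto
      have "card A = length (map \<psi> [Suc g..<n])"
        using sorted[OF \<psi>(1)] \<psi>(2) by (metis distinct_card strict_sorted_iff)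
      with \<psi> show "A \<in> \<A>" by (auto simp: \<A>_def increasing_maps_def I_def)
    next
      fix A assume A: "A \<in> \<A>"
      define xs where "xs = sorted_list_of_set A"
      \<comment> \<open>The increasing enumeration of \<open>A\<close>, shifted so that the first
        index is \<open>Suc g\<close>.\<close>
      define \<psi> where "\<psi> k = (if g < k \<and> k < n then xs ! (k - Suc g) else 0)" for k
      have fin: "finite A" using A by (auto simp: \<A>_def intro: finite_subset)
      have xs: "sorted_wrt (<) xs" "set xs = A" "length xs = n - 1 - g"
        using fin A by (auto simp: xs_def \<A>_def)
      have nth: "xs ! i \<in> A" if "i < n - 1 - g" for i using xs that by auto
      have "\<psi> k < \<psi> l" if "g < k" "k < l" "l < n" for k l
        using that xs by (auto simp: \<psi>_def intro!: sorted_wrt_nth_less[of "(<)"])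
      moreover have "\<psi> k \<in> {1..<n - 1}" if "g < k" "k < n" for k
      proof -
        have "k - Suc g < n - 1 - g" using that by simp
        then have "xs ! (k - Suc g) \<in> {1..<n - 1}" using nth A unfolding \<A>_def by blast
        then show ?thesis using that by (simp add: \<psi>_def)
      qed
      ultimately have "\<psi> \<in> increasing_maps g n"
        by (auto simp: increasing_maps_def \<psi>_def)
      moreover have "\<psi> ` I = A"
      proof
        show "\<psi> ` I \<subseteq> A" using nth by (auto simp: \<psi>_def I_def)
        show "A \<subseteq> \<psi> ` I"
        proof
          fix a assume "a \<in> A"
          then obtain i where "i < n - 1 - g" "a = xs ! i" using xs by (metis in_set_conv_nth)
          then have "a = \<psi> (Suc (g + i))" "Suc (g + i) \<in> I" by (auto simp: \<psi>_def I_def)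
          then show "a \<in> \<psi> ` I" by blast
        qed
      qed
      ultimately show "A \<in> (\<lambda>\<psi>. \<psi> ` I) ` increasing_maps g n" by blast
    qed
  qed
  show "finite (increasing_maps g n)"
    using bij_betw_finite[OF bij] by (simp add: \<A>_def)
  have "card (increasing_maps g n) = card \<A>" using bij by (rule bij_betw_same_card)
  also have "\<dots> = (n - 2) choose (n - 1 - g)"
    unfolding \<A>_def by (subst n_subsets) (auto simp: numeral_2_eq_2)
  finally show "card (increasing_maps g n) = (n - 2) choose (n - 1 - g)" .
qed

section \<open>Operations on an initial segment of the natural numbers\<close>

text \<open>
  The elements of a linear \<open>L\<close>-algebra are numbered from the top, so that \<open>0\<close> is the unit and the
  natural order is the reverse of the order of the numbers. The value \<open>0\<close> outside the carrier makes
  each operation determined by its restriction to the carrier.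
\<close>

definition L_chain :: "nat \<Rightarrow> (nat \<Rightarrow> nat \<Rightarrow> nat) \<Rightarrow> bool" where
  "L_chain n f \<longleftrightarrow>
     (\<forall>k<n. f 0 k = k) \<and>
     (\<forall>i k. k \<le> i \<or> n \<le> k \<longrightarrow> f i k = 0) \<and>
     (\<forall>i k. k < n \<longrightarrow> f i k < n) \<and>
     (\<forall>i k l. i \<le> k \<and> k < l \<and> l < n \<longrightarrow> f i k < f i l) \<and>
     (\<forall>i j k. i \<le> j \<and> j \<le> k \<and> k < n \<longrightarrow> f (f i j) (f i k) = f j k)"

lemma
  assumes "L_chain n f"
  shows L_chain_0: "k < n \<Longrightarrow> f 0 k = k"
    and L_chain_eq_0: "k \<le> i \<Longrightarrow> f i k = 0"
    and L_chain_outside: "n \<le> k \<Longrightarrow> f i k = 0"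
    and L_chain_less: "k < n \<Longrightarrow> f i k < n"
    and L_chain_mono: "i \<le> k \<Longrightarrow> k < l \<Longrightarrow> l < n \<Longrightarrow> f i k < f i l"
    and L_chain_cycloid: "i \<le> j \<Longrightarrow> j \<le> k \<Longrightarrow> k < n \<Longrightarrow> f (f i j) (f i k) = f j k"
  using assms by (simp_all add: L_chain_def)

lemma L_chain_gap:
  assumes "L_chain n f" "i \<le> k" "k \<le> l" "l < n"
  shows "f i k + (l - k) \<le> f i l"
  using strict_mono_bounded_le[of i n "f i"] L_chain_mono[OF assms(1)] assms by blast

text \<open>Row \<open>i\<close> rises by at least 1 at each of the \<open>n - 1 - k\<close> steps
  from \<open>k\<close> to the bottom, yet stays below \<open>n\<close>.\<close>

lemma L_chain_le:
  assumes "L_chain n f" "k < n"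
  shows "f i k \<le> k"
proof (cases "k \<le> i")
  case True
  then show ?thesis using L_chain_eq_0[OF assms(1)] by simp
next
  case False
  then have "f i k + (n - 1 - k) \<le> f i (n - 1)"
    using assms by (intro L_chain_gap) auto
  moreover have "f i (n - 1) < n" using assms by (simp add: L_chain_less)
  ultimately show ?thesis using assms(2) by linarith
qed

lemma L_chain_mono_le:
  assumes "L_chain n f" "i \<le> k" "k \<le> l" "l < n"
  shows "f i k \<le> f i l"
  using L_chain_gap[OF assms] by simp

lemma L_chain_eq_0_iff:
  assumes "L_chain n f" "k < n"
  shows "f i k = 0 \<longleftrightarrow> k \<le> i"
  using L_chain_mono[OF assms(1), of i i k] L_chain_eq_0[OF assms(1), of k i] assms(2)
  by (cases "k \<le> i") auto

text \<open>
  The operation on \<open>{..<n}\<close> with restriction \<open>h\<close> to \<open>{..<g}\<close> and row \<open>\<psi>\<close> at \<open>g\<close>. The test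
  \<open>\<psi> j < j\<close> only serves termination; it always holds for \<open>\<psi> \<in> increasing_maps g n\<close>.
\<close>

function glue :: "nat \<Rightarrow> nat \<Rightarrow> (nat \<Rightarrow> nat \<Rightarrow> nat) \<Rightarrow> (nat \<Rightarrow> nat) \<Rightarrow> nat \<Rightarrow> nat \<Rightarrow> nat" where
  "glue n g h \<psi> j k =
     (if k < g then h j k
      else if n \<le> k \<or> k \<le> j then 0
      else if j < g then k
      else if \<psi> j < j then glue n g h \<psi> (\<psi> j) (\<psi> k)
      else 0)"
  by auto
termination by (relation "measure (\<lambda>(n, g, h, \<psi>, j, k). j)") auto

declare glue.simps [simp del]

section \<open>Properties of the glued operation\<close>

context
  fixes n g :: nat and h :: "nat \<Rightarrow> nat \<Rightarrow> nat" and \<psi> :: "nat \<Rightarrow> nat"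
  assumes g: "1 \<le> g" "g < n" and h: "L_chain g h" and \<psi>: "\<psi> \<in> increasing_maps g n"
begin

text \<open>The default value at \<open>g\<close> is also the diagonal value of row
  \<open>g\<close>, so monotonicity extends to start at \<open>g\<close> itself.\<close>

lemma psi_g: "\<psi> g = 0"
  using \<psi> by (simp add: increasing_maps_def)

lemma psi_mono: "g \<le> k \<Longrightarrow> k < l \<Longrightarrow> l < n \<Longrightarrow> \<psi> k < \<psi> l"
  using \<psi> psi_g by (cases "k = g") (fastforce simp: increasing_maps_def)+

text \<open>The strict drop at \<open>n - 1\<close> propagates backwards through the unit steps. It
  makes the recursion of \<open>glue\<close> descend.\<close>

lemma psi_less:
  assumes "g \<le> k" "k < n"
  shows "\<psi> k < k"
proof (cases "k = g")
  case False
  have "\<psi> k + (n - 1 - k) \<le> \<psi> (n - 1)"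
    by (rule strict_mono_bounded_le[of g n]) (use psi_mono assms in auto)
  moreover have "\<psi> (n - 1) < n - 1"
    using \<psi> False assms by (auto simp: increasing_maps_def)
  ultimately show ?thesis using assms by linarith
qed (use psi_g g in simp)

lemma glue_lt: "k < g \<Longrightarrow> glue n g h \<psi> j k = h j k"
  by (subst glue.simps) simp

lemma glue_id: "j < g \<Longrightarrow> g \<le> k \<Longrightarrow> k < n \<Longrightarrow> glue n g h \<psi> j k = k"
  by (subst glue.simps) simp

lemma glue_eq_0: "k \<le> j \<or> n \<le> k \<Longrightarrow> glue n g h \<psi> j k = 0"
  using g L_chain_eq_0[OF h] L_chain_outside[OF h] by (subst glue.simps) auto

lemma glue_0: "k < n \<Longrightarrow> glue n g h \<psi> 0 k = k"
  using g L_chain_0[OF h] by (subst glue.simps) auto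

text \<open>This is the defining equation for \<open>g\<close>, \<open>j\<close>, \<open>k\<close>
  with \<open>\<psi>\<close> as row \<open>g\<close>. On the diagonal both sides vanish.\<close>

lemma glue_rec:
  assumes "g \<le> j" "j \<le> k" "k < n"
  shows "glue n g h \<psi> j k = glue n g h \<psi> (\<psi> j) (\<psi> k)"
proof (cases "j = k")
  case True
  then show ?thesis by (simp add: glue_eq_0)
next
  case False
  then show ?thesis
    using assms psi_less[of j] by (subst glue.simps) auto
qed

lemma glue_g: "g \<le> k \<Longrightarrow> k < n \<Longrightarrow> glue n g h \<psi> g k = \<psi> k"
  using glue_rec[of g k] psi_g glue_0 psi_less[of k] by simp

lemma psi_mono_le: "g \<le> k \<Longrightarrow> k \<le> l \<Longrightarrow> l < n \<Longrightarrow> \<psi> k \<le> \<psi> l"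
  using psi_mono[of k l] by (cases "k = l") auto

lemma psi_less_n: "g \<le> k \<Longrightarrow> k < n \<Longrightarrow> \<psi> k < n"
  using psi_less[of k] by simp

lemma glue_less: "k < n \<Longrightarrow> glue n g h \<psi> j k < n"
proof (induction j arbitrary: k rule: less_induct)
  case (less j)
  consider "k < g" | "g \<le> k" "k \<le> j" | "g \<le> k" "j < g" | "g \<le> j" "j < k" by linarith
  then show ?case
  proof cases
    case 1
    then show ?thesis using L_chain_less[OF h, of k j] g by (simp add: glue_lt)
  next
    case 4
    then show ?thesis using less psi_less[of j] psi_less_n[of k] by (simp add: glue_rec)
  qed (use less g in \<open>simp_all add: glue_eq_0 glue_id\<close>)
qed

lemma glue_mono: "j \<le> k \<Longrightarrow> k < l \<Longrightarrow> l < n \<Longrightarrow> glue n g h \<psi> j k < glue n g h \<psi> j l"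
proof (induction j arbitrary: k l rule: less_induct)
  case (less j)
  consider "l < g" | "k < g" "g \<le> l" | "g \<le> k" "j < g" | "g \<le> j" using less by linarith
  then show ?case
  proof cases
    case 1
    then show ?thesis using L_chain_mono[OF h, of j k l] less by (simp add: glue_lt)
  next
    case 2
    then show ?thesis using L_chain_less[OF h, of k j] less by (simp add: glue_lt glue_id)
  next
    case 3
    then show ?thesis using less by (simp add: glue_id)
  next
    case 4
    then have "\<psi> j < j" "\<psi> j \<le> \<psi> k" "\<psi> k < \<psi> l" "\<psi> l < n"
      using less.prems by (auto intro: psi_less psi_mono_le psi_mono psi_less_n)
    then show ?thesis using less 4 by (simp add: glue_rec)
  qed
qed

text \<open>Rows before \<open>g\<close> act as \<open>h\<close> below \<open>g\<close> and as the
  identity from \<open>g\<close> on. For later rows, \<open>glue_rec\<close> replaces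
  \<open>i\<close>, \<open>j\<close>, \<open>k\<close> by their images under \<open>\<psi>\<close>
  on both sides, and the induction hypothesis applies at \<open>\<psi> i < i\<close>.\<close>

lemma glue_cycloid:
  "i \<le> j \<Longrightarrow> j \<le> k \<Longrightarrow> k < n \<Longrightarrow>
   glue n g h \<psi> (glue n g h \<psi> i j) (glue n g h \<psi> i k) = glue n g h \<psi> j k"
proof (induction i arbitrary: j k rule: less_induct)
  case (less i)
  consider "k < g" | "j < g" "g \<le> k" | "g \<le> j" "i < g" | "g \<le> i" using less by linarith
  then show ?case
  proof cases
    case 1
    then show ?thesis
      using less L_chain_cycloid[OF h, of i j k] L_chain_less[OF h, of k i] by (simp add: glue_lt)
  next
    case 2
    then show ?thesis
      using less L_chain_less[OF h, of j i] by (simp add: glue_lt glue_id)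
  next
    case 3
    then show ?thesis using less by (simp add: glue_id)
  next
    case 4
    then have "\<psi> i < i" "\<psi> i \<le> \<psi> j" "\<psi> j \<le> \<psi> k" "\<psi> k < n"
      using less.prems by (auto intro: psi_less psi_mono_le psi_less_n)
    then show ?thesis using less 4 by (simp add: glue_rec)
  qed
qed

lemma L_chain_glue: "L_chain n (glue n g h \<psi>)"
  unfolding L_chain_def using glue_0 glue_eq_0 glue_less glue_mono glue_cycloid by auto

text \<open>Together with the next two lemmas this recovers \<open>g\<close>, \<open>h\<close> and
  \<open>\<psi>\<close> from the glued operation.\<close>

lemma Least_glue: "(LEAST i. glue n g h \<psi> i (n - 1) < n - 1) = g"
proof (rule Least_equality)
  show "glue n g h \<psi> g (n - 1) < n - 1"
    using glue_g[of "n - 1"] psi_less[of "n - 1"] g by simp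
  show "g \<le> i" if "glue n g h \<psi> i (n - 1) < n - 1" for i
    using glue_id[of i "n - 1"] g that by (cases "g \<le> i") auto
qed

lemma restrict_glue: "(\<lambda>j k. if k < g then glue n g h \<psi> j k else 0) = h"
  using L_chain_outside[OF h] by (intro ext) (simp add: glue_lt)

lemma glue_row: "glue n g h \<psi> g = \<psi>"
proof
  show "glue n g h \<psi> g k = \<psi> k" for k
    using glue_g[of k] glue_eq_0[of k g] \<psi> by (cases "g \<le> k \<and> k < n") (auto simp: increasing_maps_def)
qed

end

section \<open>Cutting an operation at the first row that moves the bottom\<close>

lemma L_chain_split:
  assumes f: "L_chain n f" and n: "2 \<le> n"
  defines "g \<equiv> LEAST i. f i (n - 1) < n - 1"
  defines "h \<equiv> \<lambda>j k. if k < g then f j k else 0"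
  shows "1 \<le> g" "g < n" "L_chain g h" "f g \<in> increasing_maps g n" "glue n g h (f g) = f"
proof -
  \<comment> \<open>The bottom's own row sends it to 0, so the least index exists.\<close>
  have ex: "f (n - 1) (n - 1) < n - 1" using n L_chain_eq_0[OF f, of "n - 1" "n - 1"] by simp
  have g_less: "f g (n - 1) < n - 1" unfolding g_def using ex by (rule LeastI)
  have minimal: "g \<le> i" if "f i (n - 1) < n - 1" for i
    unfolding g_def using that by (rule Least_le)
  have last: "f j (n - 1) = n - 1" if "j < g" for j
    using that minimal[of j] L_chain_less[OF f, of "n - 1" j] n by (cases "f j (n - 1) < n - 1") auto
  show gn: "g < n" using minimal[OF ex] n by simp
  show g1: "1 \<le> g" using g_less L_chain_0[OF f, of "n - 1"] n by (cases "g = 0") auto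
  have fixed: "f j g = g" if "j < g" for j
  proof -
    \<comment> \<open>Row \<open>j\<close> fixes the bottom, so row \<open>f j g\<close> moves it
      just as row \<open>g\<close> does; minimality gives \<open>g \<le> f j g\<close>.\<close>
    have "f (f j g) (n - 1) = f g (n - 1)"
      using L_chain_cycloid[OF f, of j g "n - 1"] that gn last[OF that] by simp
    then have "g \<le> f j g" using g_less minimal by simp
    then show ?thesis using L_chain_le[OF f gn, of j] by simp
  qed
  have fixed': "f j k = k" if "j < g" "g \<le> k" "k < n" for j k
    \<comment> \<open>Unit steps from the fixed point \<open>g\<close> give
      \<open>k \<le> f j k\<close>; \<open>L_chain_le\<close> gives the converse.\<close>
    using L_chain_gap[OF f, of j g k] fixed[of j] that L_chain_le[OF f, of k j] by simp
  show h: "L_chain g h"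
    unfolding L_chain_def
  proof (intro conjI allI impI)
    show "h 0 k = k" if "k < g" for k using that gn L_chain_0[OF f] by (simp add: h_def)
    show "h i k = 0" if "k \<le> i \<or> g \<le> k" for i k
      using that L_chain_eq_0[OF f] by (auto simp: h_def)
    show "h i k < g" if "k < g" for i k
      using that L_chain_le[OF f, of k i] gn by (simp add: h_def)
    show "h i k < h i l" if "i \<le> k \<and> k < l \<and> l < g" for i k l
      using that L_chain_mono[OF f, of i k l] gn by (simp add: h_def)
    show "h (h i j) (h i k) = h j k" if "i \<le> j \<and> j \<le> k \<and> k < g" for i j k
      using that L_chain_cycloid[OF f, of i j k] L_chain_le[OF f, of k i] gn by (simp add: h_def)
  qed
  show \<psi>: "f g \<in> increasing_maps g n"
    unfolding increasing_maps_def
  proof (intro CollectI conjI allI impI)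
    show "f g k = 0" if "\<not> (g < k \<and> k < n)" for k
      using that L_chain_eq_0[OF f] L_chain_outside[OF f] by auto
    fix k assume k: "g < k \<and> k < n"
    show "1 \<le> f g k" using k L_chain_mono[OF f, of g g k] by simp
    show "f g k < n - 1"
      using k L_chain_mono_le[OF f, of g k "n - 1"] g_less by linarith
  next
    show "f g k < f g l" if "g < k \<and> k < l \<and> l < n" for k l
      using that L_chain_mono[OF f, of g k l] by simp
  qed
  note G = g1 gn h \<psi>
  have "glue n g h (f g) j k = f j k" for j k
  proof (induction j arbitrary: k rule: less_induct)
    case (less j)
    consider "k < g" | "k \<le> j \<or> n \<le> k" | "g \<le> k" "k < n" "j < g" | "g \<le> j" "j < k" "k < n" by linarith
    then show ?case
    proof cases
      case 1
      then show ?thesis using glue_lt[OF G, of k j] by (simp add: h_def)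
    next
      case 2
      then show ?thesis
        using L_chain_eq_0[OF f] L_chain_outside[OF f] glue_eq_0[OF G] by auto
    next
      case 3
      then show ?thesis using fixed' by (simp add: glue_id[OF G])
    next
      case 4
      then have "f g j < j" using psi_less[OF G, of j] by simp
      \<comment> \<open>The equation for \<open>g\<close>, \<open>j\<close>, \<open>k\<close> is the
        recursion of \<open>glue\<close>, and the row index drops to \<open>f g j\<close>.\<close>
      then show ?thesis
        using 4 less L_chain_cycloid[OF f, of g j k] by (simp add: glue_rec[OF G])
    qed
  qed
  then show "glue n g h (f g) = f" by blast
qed

text \<open>For \<open>n = 1\<close> the index range \<open>{1..<n}\<close> is empty although one
  operation exists, hence the lower bound 2.\<close>

lemma bij_betw_glue:
  assumes "2 \<le> n"
  shows "bij_betw (\<lambda>(g, h, \<psi>). glue n g h \<psi>)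
           (SIGMA g:{1..<n}. {h. L_chain g h} \<times> increasing_maps g n) {f. L_chain n f}"
proof (rule bij_betw_byWitness[where f' = "\<lambda>f. let g = LEAST i. f i (n - 1) < n - 1 in
    (g, \<lambda>j k. if k < g then f j k else 0, f g)"])
qed (auto simp: Let_def Least_glue restrict_glue glue_row L_chain_glue L_chain_split[OF _ assms]
    simp del: One_nat_def)

section \<open>Counting the operations\<close>

lemma L_chain_1: "L_chain 1 f \<longleftrightarrow> f = (\<lambda>i k. 0)"
proof
  assume f: "L_chain 1 f"
  have "f i k = 0" for i k
    using L_chain_eq_0[OF f, of k i] L_chain_outside[OF f, of k i] by linarith
  then show "f = (\<lambda>i k. 0)" by blast
qed (simp add: L_chain_def)

text \<open>Finiteness is carried through the induction because the cardinality of the disjoint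
  union over \<open>g\<close> relies on it.\<close>

lemma card_L_chains:
  "finite {f. L_chain (Suc m) f} \<and> card {f. L_chain (Suc m) f} = Bell m"
proof (induction m rule: less_induct)
  case (less m)
  show ?case
  proof (cases m)
    case 0
    then show ?thesis by (simp add: L_chain_1[unfolded One_nat_def] Bell_0)
  next
    case (Suc p)
    let ?n = "Suc m"
    let ?D = "SIGMA g:{1..<?n}. {h. L_chain g h} \<times> increasing_maps g ?n"
    have IH: "finite {h. L_chain g h}" "card {h. L_chain g h} = Bell (g - 1)" if "g \<in> {1..<?n}" for g
      using less.IH[of "g - 1"] that by auto
    have bij: "bij_betw (\<lambda>(g, h, \<psi>). glue ?n g h \<psi>) ?D {f. L_chain ?n f}"
      using Suc by (intro bij_betw_glue) simp
    have fin: "finite ?D"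
      using IH(1) card_increasing_maps(1) by (intro finite_SigmaI finite_cartesian_product) auto
    have "card ?D = (\<Sum>g\<in>{1..<?n}. card ({h. L_chain g h} \<times> increasing_maps g ?n))"
      using IH(1) card_increasing_maps(1) by (intro card_SigmaI) auto
    also have "\<dots> = (\<Sum>g\<in>{1..<?n}. (p choose (g - 1)) * Bell (g - 1))"
    proof (rule sum.cong)
      fix g assume g: "g \<in> {1..<?n}"
      \<comment> \<open>Rows are counted by \<open>p choose (m - g)\<close>; complementation gives
        the form in \<open>Bell_Suc\<close>.\<close>
      have "g - 1 \<le> p" "p - (g - 1) = m - g" using g Suc by auto
      then have "p choose (m - g) = p choose (g - 1)"
        using binomial_symmetric[of "g - 1" p] by simp
      then show "card ({h. L_chain g h} \<times> increasing_maps g ?n) = (p choose (g - 1)) * Bell (g - 1)"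
        using g Suc by (simp add: card_cartesian_product card_increasing_maps(2) IH(2))
    qed simp
    also have "\<dots> = (\<Sum>k\<le>p. (p choose k) * Bell k)"
      by (rule sum.reindex_bij_witness[of _ Suc "\<lambda>g. g - 1"]) (auto simp: Suc)
    also have "\<dots> = Bell m" by (simp add: Suc Bell_Suc)
    finally show ?thesis
      using bij_betw_same_card[OF bij] bij_betw_finite[OF bij] fin by simp
  qed
qed

section \<open>Isomorphism classes\<close>

lemma L_chain_unit:
  assumes "L_chain n f" "0 < n"
  shows "logical_unit {..<n} f 0"
  using assms L_chain_0 L_chain_eq_0 by (auto simp: logical_unit_def)

lemma L_chain_linear_L_algebra:
  assumes f: "L_chain n f" and n: "0 < n"
  shows "({..<n}, f) \<in> linear_L_algebras n"
proof -
  have zero: "f i k = 0 \<longleftrightarrow> k \<le> i" if "k < n" for i k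
    using L_chain_eq_0_iff[OF f that] .
  \<comment> \<open>The equation is symmetric in \<open>x\<close> and \<open>y\<close>, so
    \<open>x \<le> y\<close> suffices. Both sides then equal \<open>f y z\<close>, which is 0 when
    \<open>z < y\<close>.\<close>
  have *: "f (f x y) (f x z) = f (f y x) (f y z)" if "x \<le> y" "y < n" "z < n" for x y z
  proof -
    have "f (f y x) (f y z) = f y z"
      using that L_chain_eq_0[OF f, of x y] L_chain_0[OF f] L_chain_less[OF f, of z y] by simp
    moreover have "f (f x y) (f x z) = f y z"
    proof (cases "y \<le> z")
      case True
      then show ?thesis using L_chain_cycloid[OF f] that by simp
    next
      case False
      have "f x z \<le> f x y"
        using that False L_chain_mono_le[OF f, of x z y] L_chain_eq_0[OF f, of z x]
        by (cases "x \<le> z") auto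
      then show ?thesis using False L_chain_eq_0[OF f] by simp
    qed
    ultimately show ?thesis by simp
  qed
  have "L_algebra {..<n} f"
    unfolding L_algebra_def
  proof (intro conjI exI[of _ 0])
    show "\<forall>x\<in>{..<n}. \<forall>y\<in>{..<n}. \<forall>z\<in>{..<n}. f (f x y) (f x z) = f (f y x) (f y z)"
      using * by (metis lessThan_iff nat_le_linear)
  qed (use L_chain_unit[OF f n] L_chain_less[OF f] zero in auto)
  moreover have "\<forall>x\<in>{..<n}. \<forall>y\<in>{..<n}. L_le {..<n} f x y \<or> L_le {..<n} f y x"
    unfolding L_le_def L_unit_eq[OF L_chain_unit[OF f n]] using zero by auto
  ultimately show ?thesis
    by (simp add: linear_L_algebras_def linear_L_algebra_def)
qed

lemma L_chain_isomorphic_eq: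
  assumes f: "L_chain n f" and f': "L_chain n f'"
    and iso: "L_isomorphic ({..<n}, f) ({..<n}, f')"
  shows "f = f'"
proof -
  obtain h where h: "bij_betw h {..<n} {..<n}"
    and hom: "\<And>x y. x < n \<Longrightarrow> y < n \<Longrightarrow> h (f x y) = f' (h x) (h y)"
    using iso by (auto simp: L_isomorphic_def)
  have hn: "h x < n" if "x < n" for x using h that by (auto simp: bij_betw_def)
  have h0: "h 0 = 0" if "0 < n"
    using hom[OF that that] L_chain_eq_0[OF f] L_chain_eq_0[OF f'] by simp
  have mono: "h x < h y" if "0 \<le> x" "x < y" "y < n" for x y
  proof -
    have "f y x = 0" using L_chain_eq_0[OF f] that by simp
    then have "f' (h y) (h x) = 0" using hom[of y x] h0 that by simp
    then have "h x \<le> h y" using L_chain_eq_0_iff[OF f' hn[of x]] that by simp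
    moreover have "h x \<noteq> h y" using h that by (auto simp: bij_betw_def inj_on_def)
    ultimately show ?thesis by simp
  qed
  have h_id: "h x = x" if "x < n" for x
  proof -
    \<comment> \<open>Unit steps from 0 force \<open>x \<le> h x\<close>; unit steps up to
      \<open>n - 1\<close> force \<open>h x \<le> x\<close>.\<close>
    have "h 0 + (x - 0) \<le> h x" "h x + (n - 1 - x) \<le> h (n - 1)"
      by (rule strict_mono_bounded_le[of 0 n]; use mono that in simp)+
    then show ?thesis using hn[of "n - 1"] that by simp
  qed
  show ?thesis
  proof (intro ext)
    fix i k
    consider "k \<le> i" | "n \<le> k" | "i < k" "k < n" by linarith
    then show "f i k = f' i k"
    proof cases
      case 3
      then show ?thesis using hom[of i k] L_chain_less[OF f, of k i] h_id by simp
    qed (use L_chain_eq_0 L_chain_outside f f' in metis)+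
  qed
qed

lemma linear_L_algebra_isomorphic_L_chain:
  assumes "(X, f) \<in> linear_L_algebras n"
  shows "\<exists>g. L_chain n g \<and> L_isomorphic ({..<n}, g) (X, f)"
proof -
  have fin: "finite X" and n: "card X = n" and lin: "linear_L_algebra X f"
    using assms by (auto simp: linear_L_algebras_def)
  have closed: "\<And>x y. x \<in> X \<Longrightarrow> y \<in> X \<Longrightarrow> f x y \<in> X"
    and cycloid: "\<And>x y z. x \<in> X \<Longrightarrow> y \<in> X \<Longrightarrow> z \<in> X \<Longrightarrow> f (f x y) (f x z) = f (f y x) (f y z)"
    using lin by (auto simp: linear_L_algebra_def L_algebra_def)
  obtain e where e: "logical_unit X f e"
    and anti: "\<And>x y. x \<in> X \<Longrightarrow> y \<in> X \<Longrightarrow> f x y = e \<Longrightarrow> f y x = e \<Longrightarrow> x = y"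
    using lin unfolding linear_L_algebra_def L_algebra_def by blast
  have unit: "e \<in> X" "\<And>x. x \<in> X \<Longrightarrow> f e x = x" "\<And>x. x \<in> X \<Longrightarrow> f x e = e" "\<And>x. x \<in> X \<Longrightarrow> f x x = e"
    using e by (auto simp: logical_unit_def)
  have tot: "\<And>x y. x \<in> X \<Longrightarrow> y \<in> X \<Longrightarrow> f x y = e \<or> f y x = e"
    using lin L_unit_eq[OF e] by (auto simp: linear_L_algebra_def L_le_def)
  \<comment> \<open>If \<open>x\<close> lies below \<open>y\<close>, then \<open>f x y = e\<close>
    and the other side of the equation collapses to \<open>f x z\<close>.\<close>
  have below: "f (f y x) (f y z) = f x z" if "x \<in> X" "y \<in> X" "z \<in> X" "f x y = e" for x y z
    using cycloid[of x y z] that unit closed by simp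
  have trans: "f x z = e" if "x \<in> X" "y \<in> X" "z \<in> X" "f x y = e" "f y z = e" for x y z
    using below[of x y z] that unit closed by simp
  define up where "up x = {y \<in> X. f x y = e \<and> y \<noteq> x}" for x
  \<comment> \<open>The number of elements strictly above \<open>x\<close> is its position counted
    from the top.\<close>
  define r where "r x = card (up x)" for x
  have fin_up: "finite (up x)" for x using fin by (simp add: up_def)
  have r_less: "r y < r x" if "x \<in> X" "y \<in> X" "f x y = e" "x \<noteq> y" for x y
  proof -
    have "up y \<subseteq> up x" using that trans[of x y] anti[of x y] by (auto simp: up_def)
    moreover have "y \<in> up x" "y \<notin> up y" using that by (auto simp: up_def)
    ultimately have "up y \<subset> up x" by blast
    then show ?thesis unfolding r_def by (rule psubset_card_mono[OF fin_up])
  qed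
  have r_le_iff: "r y \<le> r x \<longleftrightarrow> f x y = e" if "x \<in> X" "y \<in> X" for x y
    using r_less[of x y] r_less[of y x] tot[OF that] that unit(4) anti[OF that]
    by (metis leD le_cases order_refl order.strict_implies_order)
  have inj: "inj_on r X"
    by (rule inj_onI) (metis anti order_refl r_le_iff)
  have r_n: "r x < n" if "x \<in> X" for x
    unfolding r_def n[symmetric] using that by (intro psubset_card_mono fin) (auto simp: up_def)
  have r_image: "r ` X = {..<n}"
    by (rule card_subset_eq) (use r_n n inj in \<open>auto simp: card_image\<close>)
  define s where "s = inv_into X r"
  have s: "bij_betw s {..<n} X"
    using inj r_image unfolding s_def by (simp add: bij_betw_def bij_betw_inv_into[unfolded bij_betw_def])
  have sX: "s i \<in> X" if "i < n" for i using s that by (auto simp: bij_betw_def)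
  have rs: "r (s i) = i" if "i < n" for i
    using that r_image by (simp add: s_def f_inv_into_f)
  have sr: "s (r x) = x" if "x \<in> X" for x using that inj by (simp add: s_def)
  have f_s: "f (s i) (s k) = e \<longleftrightarrow> k \<le> i" if "i < n" "k < n" for i k
    using r_le_iff[of "s i" "s k"] that by (simp add: sX rs)
  have "up e = {}" using unit by (auto simp: up_def)
  then have r_e: "r e = 0" by (simp add: r_def)
  define g where "g i k = (if i < n \<and> k < n then r (f (s i) (s k)) else 0)" for i k
  have sg: "s (g i k) = f (s i) (s k)" if "i < n" "k < n" for i k
    using that by (simp add: g_def sr closed sX)
  have g_less: "g i k < n" if "k < n" for i k
    using that r_n closed sX by (simp add: g_def)
  have "L_chain n g"
    unfolding L_chain_def
  proof (intro conjI allI impI)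
    show "g 0 k = k" if "k < n" for k
      using that sr[OF unit(1)] by (simp add: g_def r_e unit sX rs)
    show "g i k = 0" if "k \<le> i \<or> n \<le> k" for i k
      using that f_s[of i k] r_e by (auto simp: g_def)
    show "g i k < n" if "k < n" for i k using that by (rule g_less)
    show "g i k < g i l" if *: "i \<le> k \<and> k < l \<and> l < n" for i k l
    proof -
      \<comment> \<open>If row \<open>i\<close> did not increase from \<open>k\<close> to
        \<open>l\<close>, the left side would be \<open>e\<close>; the right side is not, since
        \<open>k < l\<close>.\<close>
      have "f (f (s i) (s k)) (f (s i) (s l)) = f (s k) (s l)"
        using * by (intro below) (auto simp: sX f_s)
      then have "f (f (s i) (s k)) (f (s i) (s l)) \<noteq> e" using * f_s[of k l] by simp
      then have "\<not> r (f (s i) (s l)) \<le> r (f (s i) (s k))"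
        using * by (subst r_le_iff) (auto simp: closed sX)
      then show ?thesis using * by (simp add: g_def)
    qed
    show "g (g i j) (g i k) = g j k" if *: "i \<le> j \<and> j \<le> k \<and> k < n" for i j k
    proof -
      have "f (f (s i) (s j)) (f (s i) (s k)) = f (s j) (s k)"
        using * by (intro below) (auto simp: sX f_s)
      then have "s (g (g i j) (g i k)) = s (g j k)"
        using * g_less by (simp add: sg)
      then show ?thesis using * g_less rs by metis
    qed
  qed
  moreover have "L_isomorphic ({..<n}, g) (X, f)"
    unfolding L_isomorphic_def using s sg by auto
  ultimately show ?thesis by blast
qed

text \<open>Each class contains exactly one operation of the form \<open>L_chain\<close>: numbering
  from the top gives existence, rigidity gives uniqueness.\<close>

lemma num_linear_L_algebras_eq:
  assumes "0 < n"
  shows "num_linear_L_algebras n = card {f. L_chain n f}"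
proof -
  define cls where "cls f = L_iso_rel n `` {({..<n}, f)}" for f
  have mem: "({..<n}, f) \<in> linear_L_algebras n" if "L_chain n f" for f
    using L_chain_linear_L_algebra[OF that assms] .
  have "bij_betw cls {f. L_chain n f} (linear_L_algebras n // L_iso_rel n)"
  proof (rule bij_betw_imageI)
    show "inj_on cls {f. L_chain n f}"
    proof (rule inj_onI, clarify)
      fix f f' assume f: "L_chain n f" "L_chain n f'" and "cls f = cls f'"
      then have "(({..<n}, f), ({..<n}, f')) \<in> L_iso_rel n"
        unfolding cls_def using equiv_L_iso_rel mem by (metis eq_equiv_class)
      then show "f = f'"
        using f by (intro L_chain_isomorphic_eq) (auto simp: L_iso_rel_def)
    qed
    show "cls ` {f. L_chain n f} = linear_L_algebras n // L_iso_rel n"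
    proof (intro equalityI subsetI)
      show "C \<in> linear_L_algebras n // L_iso_rel n" if "C \<in> cls ` {f. L_chain n f}" for C
        using that mem by (auto simp: cls_def intro: quotientI)
    next
      fix C assume "C \<in> linear_L_algebras n // L_iso_rel n"
      then obtain X f where Xf: "(X, f) \<in> linear_L_algebras n" "C = L_iso_rel n `` {(X, f)}"
        by (auto elim: quotientE)
      obtain g where g: "L_chain n g" "L_isomorphic ({..<n}, g) (X, f)"
        using linear_L_algebra_isomorphic_L_chain[OF Xf(1)] by blast
      then have "(({..<n}, g), (X, f)) \<in> L_iso_rel n"
        using Xf mem by (simp add: L_iso_rel_def)
      then have "cls g = C"
        unfolding cls_def Xf(2) by (rule equiv_class_eq[OF equiv_L_iso_rel])
      then show "C \<in> cls ` {f. L_chain n f}" using g(1) by blast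
    qed
  qed
  then show ?thesis
    unfolding num_linear_L_algebras_def by (simp add: bij_betw_same_card)
qed

theorem theorem4p5:
  fixes n :: nat
  assumes "n \<ge> 1"
  shows "num_linear_L_algebras n = Bell (n - 1)"
  using num_linear_L_algebras_eq[of n] card_L_chains[of "n - 1"] assms by simp

end
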